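(* The fundamental group of the circle is equivalent to the integers: $\Pi_1(S^1,base)\simeq\mathbb{Z}$, via mutually inverse maps sending the class of $loop^n$ to $n$ and $n$ to the class of $loop^n$.
   Context: The circle $S^1$ is the higher inductive type generated by a point $base : S^1$ and a computational path $base =_{loop} base : S^1$. Computational paths are syntactic terms built using reflexivity $\rho$, symmetry $\sigma$ (from $a=_r b$ infer $b=_{\sigma(r)} a$) and transitivity $\tau$ (from $a=_r b$, $b=_s c$ infer $a=_{\tau(r,s)}c$). $\Pi_1(S^1,base) = \{[l]_{rw}\mid base =_l base : S^1\}$ is the set of $rw$-equivalence classes of loops at $base$, with group operation $r\circ s := \tau(s,r)$. Powers: $loop^0:=\rho$, $loop^n := loop^{n-1}\circ loop$ and $loop^{-n} := loop^{-(n-1)}\circ\sigma(loop)$ for $n>0$. Two paths are $rw$-equal if one can be obtained from the other by finitely many applications (and reverse applications) of the rewrite rules of the system $LND_{EQ}$-$TRS$, which include $\tau(r,\sigma(r))\rhd\rho$, $\tau(\sigma(r),r)\rhd\rho$, $\tau(r,\rho)\rhd r$, $\tau(\rho,r)\rhd r$, $\tau(\tau(t,r),s)\rhd\tau(t,\tau(r,s))$. *)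

theory Defs
  imports "HOL-Algebra.Elementary_Groups"
begin

text \<open>
  Terms for computational paths over generating paths of type \<open>'g\<close>.
  Reflexivity carries no point, so one term may be a path between several pairs of points.
\<close>

datatype 'g cpath =
    Gen 'g
  | Rho ("\<rho>")
  | Sym "'g cpath" ("\<sigma>")
  | Trans "'g cpath" "'g cpath" ("\<tau>")

text \<open>
  \<open>E a g b\<close> says that the generator \<open>g\<close> is a path from \<open>a\<close> to \<open>b\<close>;
  \<open>is_path E a r b\<close> is the judgement that \<open>r\<close> is a computational path from \<open>a\<close> to \<open>b\<close>.
\<close>

inductive is_path :: "('a \<Rightarrow> 'g \<Rightarrow> 'a \<Rightarrow> bool) \<Rightarrow> 'a \<Rightarrow> 'g cpath \<Rightarrow> 'a \<Rightarrow> bool"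
  for E where
  gen: "E a g b \<Longrightarrow> is_path E a (Gen g) b"
| rho: "is_path E a \<rho> a"
| sym: "is_path E a r b \<Longrightarrow> is_path E b (\<sigma> r) a"
| trans: "is_path E a r b \<Longrightarrow> is_path E b s c \<Longrightarrow> is_path E a (\<tau> r s) c"

text \<open>
  One rewrite step: the rules of the system $LND_{EQ}$-$TRS$ whose terms are built from
  \<open>\<rho>\<close>, \<open>\<sigma>\<close> and \<open>\<tau>\<close> only, applied to an arbitrary subterm (the last three clauses).
\<close>

inductive rw_step :: "'g cpath \<Rightarrow> 'g cpath \<Rightarrow> bool" (infix "\<rhd>" 50) where
  sr:   "\<sigma> \<rho> \<rhd> \<rho>"
| ss:   "\<sigma> (\<sigma> r) \<rhd> r"
| tr:   "\<tau> r (\<sigma> r) \<rhd> \<rho>"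
| tsr:  "\<tau> (\<sigma> r) r \<rhd> \<rho>"
| rrr:  "\<tau> r \<rho> \<rhd> r"
| lrr:  "\<tau> \<rho> r \<rhd> r"
| stss: "\<sigma> (\<tau> r s) \<rhd> \<tau> (\<sigma> s) (\<sigma> r)"
| tt:   "\<tau> (\<tau> t r) s \<rhd> \<tau> t (\<tau> r s)"
| tts:  "\<tau> u (\<tau> (\<sigma> u) v) \<rhd> v"
| tst:  "\<tau> (\<sigma> u) (\<tau> u v) \<rhd> v"
| in_sym:     "r \<rhd> r' \<Longrightarrow> \<sigma> r \<rhd> \<sigma> r'"
| in_trans_l: "r \<rhd> r' \<Longrightarrow> \<tau> r s \<rhd> \<tau> r' s"
| in_trans_r: "s \<rhd> s' \<Longrightarrow> \<tau> r s \<rhd> \<tau> r s'"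

text \<open>
  Every term in a chain of forward and backward steps has to be a path with the given end
  points; a backward step by \<open>tr\<close>, say, could otherwise introduce an ill-typed term.
\<close>

definition rw_eq :: "('a \<Rightarrow> 'g \<Rightarrow> 'a \<Rightarrow> bool) \<Rightarrow> 'a \<Rightarrow> 'a \<Rightarrow> 'g cpath \<Rightarrow> 'g cpath \<Rightarrow> bool" where
  "rw_eq E a b = equivclp (\<lambda>r s. is_path E a r b \<and> is_path E a s b \<and> r \<rhd> s)"

definition rw_class :: "('a \<Rightarrow> 'g \<Rightarrow> 'a \<Rightarrow> bool) \<Rightarrow> 'a \<Rightarrow> 'a \<Rightarrow> 'g cpath \<Rightarrow> 'g cpath set" where
  "rw_class E a b r = {s. rw_eq E a b r s}"

definition path_comp :: "'g cpath \<Rightarrow> 'g cpath \<Rightarrow> 'g cpath" where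
  "path_comp r s = \<tau> s r"

definition fundamental_group ::
    "('a \<Rightarrow> 'g \<Rightarrow> 'a \<Rightarrow> bool) \<Rightarrow> 'a \<Rightarrow> 'g cpath set monoid" where
  "fundamental_group E a =
    \<lparr>carrier = {rw_class E a a l | l. is_path E a l a},
     monoid.mult = (\<lambda>X Y. \<Union>r\<in>X. \<Union>s\<in>Y. rw_class E a a (path_comp r s)),
     one = rw_class E a a \<rho>\<rparr>"

fun path_npow :: "'g cpath \<Rightarrow> nat \<Rightarrow> 'g cpath" where
  "path_npow r 0 = \<rho>"
| "path_npow r (Suc n) = path_comp (path_npow r n) r"

definition path_pow :: "'g cpath \<Rightarrow> int \<Rightarrow> 'g cpath" where
  "path_pow r n = (if n \<ge> 0 then path_npow r (nat n) else path_npow (\<sigma> r) (nat (- n)))"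

datatype circle = base

datatype circle_gen = loop

inductive circle_path :: "circle \<Rightarrow> circle_gen \<Rightarrow> circle \<Rightarrow> bool" where
  "circle_path base loop base"

context
  fixes E :: "'a \<Rightarrow> 'g \<Rightarrow> 'a \<Rightarrow> bool"
begin

lemma rw_eq_refl [simp]: "rw_eq E a b r r"
  by (simp add: rw_eq_def equivclp_def)

lemma rw_eq_sym: "rw_eq E a b r s \<Longrightarrow> rw_eq E a b s r"
  unfolding rw_eq_def by (rule equivclp_sym)

lemma rw_eq_trans [trans]: "rw_eq E a b r s \<Longrightarrow> rw_eq E a b s t \<Longrightarrow> rw_eq E a b r t"
  unfolding rw_eq_def by (rule equivclp_trans)

lemma rw_eqI: "is_path E a r b \<Longrightarrow> is_path E a s b \<Longrightarrow> r \<rhd> s \<Longrightarrow> rw_eq E a b r s"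
  unfolding rw_eq_def by (simp add: r_into_equivclp)

lemma is_path_rw_eq: "rw_eq E a b r s \<Longrightarrow> is_path E a r b \<Longrightarrow> is_path E a s b"
  unfolding rw_eq_def by (induction rule: equivclp_induct) auto

lemma rw_eq_\<sigma>:
  assumes "rw_eq E a b r r'"
  shows "rw_eq E b a (\<sigma> r) (\<sigma> r')"
  using assms unfolding rw_eq_def
proof (induction rule: equivclp_induct)
  case base
  show ?case by (simp flip: rw_eq_def)
next
  case (step y z)
  have "rw_eq E b a (\<sigma> y) (\<sigma> z)"
    using step.hyps by (blast intro: rw_eqI is_path.sym in_sym rw_eq_sym[OF rw_eqI])
  then show ?case using step.IH rw_eq_trans unfolding rw_eq_def by blast
qed

lemma rw_eq_\<tau>_left:
  assumes "rw_eq E a b r r'" "is_path E b s c"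
  shows "rw_eq E a c (\<tau> r s) (\<tau> r' s)"
  using assms(1) unfolding rw_eq_def
proof (induction rule: equivclp_induct)
  case base
  show ?case by (simp flip: rw_eq_def)
next
  case (step y z)
  have "rw_eq E a c (\<tau> y s) (\<tau> z s)"
    using step.hyps(2)
  proof
    assume "is_path E a y b \<and> is_path E a z b \<and> y \<rhd> z"
    with assms(2) show ?thesis by (intro rw_eqI) (simp_all add: in_trans_l is_path.trans[where b = b])
  next
    assume "is_path E a z b \<and> is_path E a y b \<and> z \<rhd> y"
    with assms(2) show ?thesis by (intro rw_eq_sym[OF rw_eqI]) (simp_all add: in_trans_l is_path.trans[where b = b])
  qed
  then show ?case using step.IH rw_eq_trans unfolding rw_eq_def by blast
qed

lemma rw_eq_\<tau>_right:
  assumes "rw_eq E b c s s'" "is_path E a r b"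
  shows "rw_eq E a c (\<tau> r s) (\<tau> r s')"
  using assms(1) unfolding rw_eq_def
proof (induction rule: equivclp_induct)
  case base
  show ?case by (simp flip: rw_eq_def)
next
  case (step y z)
  have "rw_eq E a c (\<tau> r y) (\<tau> r z)"
    using step.hyps(2)
  proof
    assume "is_path E b y c \<and> is_path E b z c \<and> y \<rhd> z"
    with assms(2) show ?thesis by (intro rw_eqI) (simp_all add: in_trans_r is_path.trans[where b = b])
  next
    assume "is_path E b z c \<and> is_path E b y c \<and> z \<rhd> y"
    with assms(2) show ?thesis by (intro rw_eq_sym[OF rw_eqI]) (simp_all add: in_trans_r is_path.trans[where b = b])
  qed
  then show ?case using step.IH rw_eq_trans unfolding rw_eq_def by blast
qed

lemma rw_class_eq_iff: "rw_class E a b r = rw_class E a b s \<longleftrightarrow> rw_eq E a b r s"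
proof
  assume "rw_class E a b r = rw_class E a b s"
  moreover have "s \<in> rw_class E a b s" by (simp add: rw_class_def)
  ultimately have "s \<in> rw_class E a b r" by (simp only:)
  then show "rw_eq E a b r s" by (simp add: rw_class_def)
next
  assume *: "rw_eq E a b r s"
  show "rw_class E a b r = rw_class E a b s"
    using rw_eq_trans[OF *] rw_eq_trans[OF rw_eq_sym[OF *]] by (auto simp: rw_class_def)
qed

lemma rw_class_in_carrier:
  "is_path E a l a \<Longrightarrow> rw_class E a a l \<in> carrier (fundamental_group E a)"
  unfolding fundamental_group_def by auto

lemma rw_class_mult:
  assumes "is_path E a r a" "is_path E a s a"
  shows "rw_class E a a r \<otimes>\<^bsub>fundamental_group E a\<^esub> rw_class E a a s
    = rw_class E a a (path_comp r s)"
proof -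
  have "rw_class E a a (path_comp r' s') = rw_class E a a (path_comp r s)"
    if "r' \<in> rw_class E a a r" "s' \<in> rw_class E a a s" for r' s'
  proof -
    have r: "rw_eq E a a r' r" and s: "rw_eq E a a s' s"
      using that by (auto simp: rw_class_def intro: rw_eq_sym)
    have "is_path E a r' a"
      using is_path_rw_eq[OF rw_eq_sym[OF r] assms(1)] .
    then have "rw_eq E a a (\<tau> s' r') (\<tau> s r)"
      by (rule rw_eq_trans[OF rw_eq_\<tau>_left[OF s] rw_eq_\<tau>_right[OF r assms(2)]])
    then show ?thesis by (simp add: rw_class_eq_iff path_comp_def)
  qed
  moreover have "r \<in> rw_class E a a r" "s \<in> rw_class E a a s"
    by (auto simp: rw_class_def)
  ultimately have "(\<Union>r'\<in>rw_class E a a r. \<Union>s'\<in>rw_class E a a s.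
      rw_class E a a (path_comp r' s')) = rw_class E a a (path_comp r s)"
    by blast
  then show ?thesis
    by (simp add: fundamental_group_def)
qed

lemma group_fundamental_group: "group (fundamental_group E a)"
proof (rule groupI, goal_cases)
  case (1 X Y)
  then obtain r s where "X = rw_class E a a r" "is_path E a r a"
      "Y = rw_class E a a s" "is_path E a s a"
    by (auto simp: fundamental_group_def)
  then show ?case
    by (simp add: rw_class_mult rw_class_in_carrier path_comp_def is_path.trans[of E a s a r a])
next
  case 2
  show ?case using rw_class_in_carrier[OF is_path.rho] by (simp add: fundamental_group_def)
next
  case (3 X Y Z)
  then obtain r s t where
    "X = rw_class E a a r" and r: "is_path E a r a" and
    "Y = rw_class E a a s" and s: "is_path E a s a" and
    "Z = rw_class E a a t" and t: "is_path E a t a"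
    by (auto simp: fundamental_group_def)
  moreover have "rw_eq E a a (\<tau> t (\<tau> s r)) (\<tau> (\<tau> t s) r)"
    by (intro rw_eq_sym[OF rw_eqI] tt is_path.trans[of E a _ a] r s t)
  moreover have "is_path E a (path_comp r s) a" "is_path E a (path_comp s t) a"
    using is_path.trans[OF s r] is_path.trans[OF t s] by (simp_all add: path_comp_def)
  ultimately show ?case
    by (simp add: rw_class_mult rw_class_eq_iff) (simp add: path_comp_def)
next
  case (4 X)
  then obtain r where X: "X = rw_class E a a r" and r: "is_path E a r a"
    by (auto simp: fundamental_group_def)
  have one: "\<one>\<^bsub>fundamental_group E a\<^esub> = rw_class E a a \<rho>"
    by (simp add: fundamental_group_def)
  have "rw_eq E a a (\<tau> r \<rho>) r"
    using r by (intro rw_eqI rrr is_path.trans[of E a _ a] is_path.rho)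
  then show ?case
    using r by (simp add: X one rw_class_mult is_path.rho rw_class_eq_iff path_comp_def)
next
  case (5 X)
  then obtain r where X: "X = rw_class E a a r" and r: "is_path E a r a"
    by (auto simp: fundamental_group_def)
  have one: "\<one>\<^bsub>fundamental_group E a\<^esub> = rw_class E a a \<rho>"
    by (simp add: fundamental_group_def)
  have "rw_eq E a a (\<tau> r (\<sigma> r)) \<rho>"
    using r by (intro rw_eqI tr is_path.trans[of E a _ a] is_path.rho is_path.sym)
  then have "rw_class E a a (\<sigma> r) \<otimes>\<^bsub>fundamental_group E a\<^esub> X = \<one>\<^bsub>fundamental_group E a\<^esub>"
    using r by (simp add: X one rw_class_mult is_path.sym rw_class_eq_iff path_comp_def)
  moreover have "rw_class E a a (\<sigma> r) \<in> carrier (fundamental_group E a)"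
    using r by (intro rw_class_in_carrier is_path.sym)
  ultimately show ?case by blast
qed

end

end

theory Submission
  imports Defs
begin

text \<open>
  The signed number of occurrences of \<^term>\<open>loop\<close> in a term is invariant under every rewrite
  rule, hence a homomorphism from the fundamental group to the integers. Conversely, by induction
  on the term, each loop \<open>r\<close> is rw-equal to the power of \<^term>\<open>loop\<close> with exponent
  the signed count of \<open>r\<close>.
\<close>

text \<open>Since \<open>path_comp\<close> reverses the arguments of \<open>\<tau>\<close>, the rule
  \<open>tr\<close> makes the class of \<open>\<sigma> r\<close> a left inverse, and in a group this
  determines the inverse.\<close>

lemma rw_class_\<sigma>:
  assumes "is_path E a r a"
  shows "rw_class E a a (\<sigma> r) = inv\<^bsub>fundamental_group E a\<^esub> rw_class E a a r"
proof -
  interpret group "fundamental_group E a" by (rule group_fundamental_group)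
  have "rw_eq E a a (\<tau> r (\<sigma> r)) \<rho>"
    using assms by (intro rw_eqI tr is_path.trans[of E a _ a] is_path.rho is_path.sym)
  then have "rw_class E a a (\<sigma> r) \<otimes>\<^bsub>fundamental_group E a\<^esub> rw_class E a a r
      = \<one>\<^bsub>fundamental_group E a\<^esub>"
    using assms
    by (simp add: rw_class_mult is_path.sym path_comp_def rw_class_eq_iff)
       (simp add: fundamental_group_def rw_class_eq_iff)
  then show ?thesis
    using assms by (intro inv_equality[symmetric] rw_class_in_carrier is_path.sym)
qed

lemma is_path_npow: "is_path E a r a \<Longrightarrow> is_path E a (path_npow r n) a"
  by (induction n) (auto simp: path_comp_def intro: is_path.intros)

lemma rw_class_npow:
  assumes "is_path E a r a"
  shows "rw_class E a a (path_npow r n) = rw_class E a a r [^]\<^bsub>fundamental_group E a\<^esub> n"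
proof (induction n)
  case 0
  show ?case by (simp add: fundamental_group_def)
next
  case (Suc n)
  then show ?case
    using assms by (simp add: rw_class_mult[symmetric] is_path_npow)
qed

lemma rw_class_pow:
  assumes "is_path E a r a"
  shows "rw_class E a a (path_pow r k) = rw_class E a a r [^]\<^bsub>fundamental_group E a\<^esub> (k :: int)"
proof -
  interpret group "fundamental_group E a" by (rule group_fundamental_group)
  \<comment> \<open>For negative exponents \<open>path_pow\<close> inverts the base, while
    \<open>int_pow_def2\<close> inverts the power; \<open>nat_pow_inv\<close> reconciles the
    two.\<close>
  have "rw_class E a a (path_npow (\<sigma> r) n) = inv\<^bsub>fundamental_group E a\<^esub>
      (rw_class E a a r [^]\<^bsub>fundamental_group E a\<^esub> n)" for n
    using nat_pow_inv[OF rw_class_in_carrier[OF assms]]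
    by (simp only: rw_class_npow[OF is_path.sym[OF assms]] rw_class_\<sigma>[OF assms])
  then show ?thesis
    using rw_class_npow[OF assms] unfolding path_pow_def int_pow_def2 by simp
qed

primrec winding :: "'g cpath \<Rightarrow> int" where
  "winding (Gen g) = 1"
| "winding \<rho> = 0"
| "winding (\<sigma> r) = - winding r"
| "winding (\<tau> r s) = winding r + winding s"

text \<open>Each rule becomes an identity of the abelian group of integers, so the end points of the
  terms do not matter.\<close>

lemma winding_rw_step: "r \<rhd> s \<Longrightarrow> winding r = winding s"
  by (induction rule: rw_step.induct) simp_all

lemma winding_rw_eq: "rw_eq E a b r s \<Longrightarrow> winding r = winding s"
  unfolding rw_eq_def by (induction rule: equivclp_induct) (auto dest: winding_rw_step)

lemma winding_npow: "winding (path_npow r n) = int n * winding r"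
  by (induction n) (simp_all add: path_comp_def algebra_simps)

lemma winding_pow: "winding (path_pow r k) = k * winding r"
  by (simp add: path_pow_def winding_npow)

text \<open>With one point and one generator at it, nothing can be ill-typed. This discharges all
  typing conditions below.\<close>

lemma is_path_circle: "is_path circle_path base r base"
proof (induction r)
  case (Gen g)
  then show ?case
    by (cases g) (auto intro: is_path.gen circle_path.intros)
qed (auto intro: is_path.intros)

lemma rw_class_circle:
  "rw_class circle_path base base r = rw_class circle_path base base (path_pow (Gen loop) (winding r))"
proof -
  let ?G = "fundamental_group circle_path base"
  let ?c = "rw_class circle_path base base"
  interpret group ?G by (rule group_fundamental_group)
  have L: "?c s \<in> carrier ?G" for s by (intro rw_class_in_carrier is_path_circle)
  have "?c r = ?c (Gen loop) [^]\<^bsub>?G\<^esub> winding r"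
  proof (induction r)
    case (Gen g)
    then show ?case by (cases g) (simp add: L int_pow_1)
  next
    case Rho
    then show ?case by (simp add: fundamental_group_def)
  next
    case (Sym r)
    then show ?case by (simp add: rw_class_\<sigma> is_path_circle int_pow_neg L)
  next
    case (Trans r s)
    \<comment> \<open>The product comes out in reverse order; commutativity of addition in the
      exponent restores it.\<close>
    have "?c (\<tau> r s) = ?c s \<otimes>\<^bsub>?G\<^esub> ?c r"
      by (simp add: rw_class_mult is_path_circle path_comp_def)
    with Trans show ?case by (simp add: int_pow_mult[symmetric] L add.commute)
  qed
  then show ?thesis by (simp add: rw_class_pow is_path_circle)
qed

theorem theorem4:
  shows "\<exists>to_int to_path.
    group_isomorphisms (fundamental_group circle_path base) integer_group to_int to_path \<and>
    (\<forall>n. to_int (rw_class circle_path base base (path_pow (Gen loop) n)) = n) \<and>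
    (\<forall>n. to_path n = rw_class circle_path base base (path_pow (Gen loop) n))"
proof -
  let ?G = "fundamental_group circle_path base"
  let ?c = "rw_class circle_path base base"
  let ?to_path = "\<lambda>n. ?c (path_pow (Gen loop) n)"
  \<comment> \<open>Any representative of the class may be chosen, because \<open>winding\<close> is
    constant on it by \<open>winding_rw_eq\<close>.\<close>
  define to_int :: "circle_gen cpath set \<Rightarrow> int" where "to_int X = winding (SOME r. r \<in> X)" for X
  interpret group ?G by (rule group_fundamental_group)
  have to_int: "to_int (?c r) = winding r" for r
  proof -
    have "(SOME s. s \<in> ?c r) \<in> ?c r"
      by (rule someI[of _ r]) (simp add: rw_class_def)
    then show ?thesis
      unfolding to_int_def rw_class_def by (auto dest: winding_rw_eq)
  qed
  have carrier: "carrier ?G = range ?c"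
    by (auto simp: fundamental_group_def is_path_circle)
  have "to_int \<in> hom ?G integer_group"
    by (auto simp: hom_def carrier integer_group_def rw_class_mult is_path_circle to_int
        path_comp_def)
  \<comment> \<open>By \<open>rw_class_pow\<close> this map is exponentiation of the class of
    \<open>loop\<close>, so the claim is the law of exponents.\<close>
  moreover have "?to_path \<in> hom integer_group ?G"
    by (simp add: hom_def integer_group_def Pi_iff)
       (simp add: rw_class_pow is_path_circle rw_class_in_carrier int_pow_mult)
  moreover have "?to_path (to_int X) = X" if "X \<in> carrier ?G" for X
  proof -
    from that obtain r where "X = ?c r" unfolding carrier by blast
    then show ?thesis by (simp only: to_int rw_class_circle[symmetric])
  qed
  \<comment> \<open>The factor \<open>winding (Gen loop)\<close> in \<open>winding_pow\<close> is
    1.\<close>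
  moreover have inverse: "to_int (?to_path n) = n" for n
    by (simp add: to_int winding_pow)
  ultimately have "group_isomorphisms ?G integer_group to_int ?to_path"
    by (simp add: group_isomorphisms_def)
  with inverse show ?thesis by blast
qed

end
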